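(* Let $n\ge 4$ and let $\operatorname{SD}_{2^n}=\langle a,b\mid a^{2^{n-1}}=b^2=1,\ bab=a^{2^{n-2}-1}\rangle$ be the semidihedral group of order $2^n$. Then the width of $\operatorname{SD}_{2^n}$ equals $2n-2$, i.e. $w(\operatorname{SD}_{2^n})=2n-2$.
   Context: For a finite group $G$, a $G$-transfer system is a partial order $\to$ on the set $\operatorname{Sub}(G)$ of subgroups of $G$ such that: (i) $K\to H$ implies $K\le H$; (ii) $H\to H$ for all $H$; (iii) $L\to K$ and $K\to H$ imply $L\to H$; (iv) $K\to H$ and $L\le H$ imply $K\cap L\to H\cap L$; (v) $K\to H$ implies $gKg^{-1}\to gHg^{-1}$ for all $g\in G$. A set $S$ of pairs $(K,H)$ with $K\le H$ generates the smallest transfer system containing $S$ (obtained by closing $S$ under (ii)–(v)). The complete $G$-transfer system is the one with $K\to H$ for all $K\le H$. The width $w(G)$ is the minimal cardinality of a set generating the complete $G$-transfer system. *)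

theory Defs
  imports "HOL-Algebra.Group_Action"
begin

section \<open>Groups given by generators and relations\<close>

text \<open>
  A letter \<open>(x, True)\<close> stands for the generator \<open>x\<close> and \<open>(x, False)\<close> for its formal inverse.
  The generators are all elements of the type \<open>'a\<close>; a relation \<open>u = v\<close> is the pair \<open>(u, v)\<close>.
\<close>

type_synonym 'a gword = "('a \<times> bool) list"

inductive word_eq :: "('a gword \<times> 'a gword) set \<Rightarrow> 'a gword \<Rightarrow> 'a gword \<Rightarrow> bool"
  for R where
  refl: "word_eq R u u"
| sym: "word_eq R u v \<Longrightarrow> word_eq R v u"
| trans: "word_eq R u v \<Longrightarrow> word_eq R v w \<Longrightarrow> word_eq R u w"
| cancel: "word_eq R (u @ [(x, e), (x, \<not> e)] @ v) (u @ v)"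
| relation: "(l, r) \<in> R \<Longrightarrow> word_eq R (u @ l @ v) (u @ r @ v)"

definition word_class :: "('a gword \<times> 'a gword) set \<Rightarrow> 'a gword \<Rightarrow> 'a gword set" where
  "word_class R u = {v. word_eq R u v}"

definition presented_group :: "('a gword \<times> 'a gword) set \<Rightarrow> 'a gword set monoid" where
  "presented_group R =
    \<lparr>carrier = range (word_class R),
     mult = (\<lambda>A B. \<Union>u\<in>A. \<Union>v\<in>B. word_class R (u @ v)),
     one = word_class R []\<rparr>"

lemma word_eq_append_left: "word_eq R u v \<Longrightarrow> word_eq R (w @ u) (w @ v)"
proof (induction rule: word_eq.induct)
  case (cancel u x e v)
  show ?case using word_eq.cancel[of R "w @ u" x e v] by simp
next
  case (relation l r u v)
  then show ?case using word_eq.relation[of l r R "w @ u" v] by simp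
next
  case (sym u v)
  from sym.IH show ?case by (rule word_eq.sym)
next
  case (trans u v v')
  from trans.IH show ?case by (rule word_eq.trans)
qed (rule word_eq.refl)

lemma word_eq_append_right: "word_eq R u v \<Longrightarrow> word_eq R (u @ w) (v @ w)"
proof (induction rule: word_eq.induct)
  case (cancel u x e v)
  show ?case using word_eq.cancel[of R u x e "v @ w"] by simp
next
  case (relation l r u v)
  then show ?case using word_eq.relation[of l r R u "v @ w"] by simp
next
  case (sym u v)
  from sym.IH show ?case by (rule word_eq.sym)
next
  case (trans u v v')
  from trans.IH show ?case by (rule word_eq.trans)
qed (rule word_eq.refl)

lemma word_class_eq_iff: "word_class R u = word_class R v \<longleftrightarrow> word_eq R u v"
proof
  assume "word_class R u = word_class R v"
  moreover have "v \<in> word_class R v" by (simp add: word_class_def word_eq.refl)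
  ultimately show "word_eq R u v" by (auto simp: word_class_def)
next
  assume uv: "word_eq R u v"
  have "word_eq R u w \<longleftrightarrow> word_eq R v w" for w
    using word_eq.trans[OF uv, of w] word_eq.trans[OF word_eq.sym[OF uv], of w] by blast
  then show "word_class R u = word_class R v" by (simp add: word_class_def)
qed

lemma mult_word_class:
  "word_class R u \<otimes>\<^bsub>presented_group R\<^esub> word_class R v = word_class R (u @ v)"
proof -
  have "word_class R (u' @ v') = word_class R (u @ v)"
    if "u' \<in> word_class R u" "v' \<in> word_class R v" for u' v'
  proof -
    have "word_eq R u u'" "word_eq R v v'"
      using that by (simp_all add: word_class_def)
    then have "word_eq R (u @ v) (u' @ v')"
      by (rule word_eq.trans[OF word_eq_append_right word_eq_append_left])
    then show ?thesis
      unfolding word_class_eq_iff by (rule word_eq.sym)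
  qed
  then have "(\<Union>u'\<in>word_class R u. \<Union>v'\<in>word_class R v. word_class R (u' @ v')) =
      (\<Union>u'\<in>word_class R u. \<Union>v'\<in>word_class R v. word_class R (u @ v))"
    by (intro SUP_cong HOL.refl)
  moreover have "u \<in> word_class R u" "v \<in> word_class R v"
    by (simp_all add: word_class_def word_eq.refl)
  then have "word_class R u \<noteq> {}" "word_class R v \<noteq> {}" by blast+
  ultimately show ?thesis by (simp add: presented_group_def)
qed

lemma word_eq_left_inverse: "word_eq R (rev (map (\<lambda>(x, e). (x, \<not> e)) u) @ u) []"
proof (induction u)
  case (Cons p u)
  obtain x e where p: "p = (x, e)" by fastforce
  show ?case
    using word_eq.trans[OF word_eq.cancel[of R "rev (map (\<lambda>(x, e). (x, \<not> e)) u)" x "\<not> e" u] Cons.IH] p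
    by simp
qed (simp add: word_eq.refl)

lemma carrier_presented_group: "carrier (presented_group R) = range (word_class R)"
  and one_presented_group: "\<one>\<^bsub>presented_group R\<^esub> = word_class R []"
  by (simp_all add: presented_group_def)

lemma group_presented_group: "group (presented_group R)"
proof (rule groupI)
  fix x assume "x \<in> carrier (presented_group R)"
  then obtain u where u: "x = word_class R u" by (auto simp: carrier_presented_group)
  let ?v = "rev (map (\<lambda>(x, e). (x, \<not> e)) u)"
  have "word_class R ?v \<otimes>\<^bsub>presented_group R\<^esub> x = word_class R []"
    using word_eq_left_inverse[of R u] by (simp add: u mult_word_class word_class_eq_iff)
  then show "\<exists>y\<in>carrier (presented_group R). y \<otimes>\<^bsub>presented_group R\<^esub> x = \<one>\<^bsub>presented_group R\<^esub>"
    by (auto simp: carrier_presented_group one_presented_group)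
qed (auto simp: carrier_presented_group one_presented_group mult_word_class)

section \<open>Semidihedral groups\<close>

datatype sd_generator = Gen_a | Gen_b

abbreviation word_a :: "sd_generator gword" where "word_a \<equiv> [(Gen_a, True)]"
abbreviation word_b :: "sd_generator gword" where "word_b \<equiv> [(Gen_b, True)]"

definition word_power :: "'a gword \<Rightarrow> nat \<Rightarrow> 'a gword" where
  "word_power u k = concat (replicate k u)"

text \<open>The parameter \<open>n\<close> is the exponent in the group order \<open>2 ^ n\<close>; intended for \<open>n \<ge> 4\<close>.\<close>

definition semidihedral_group :: "nat \<Rightarrow> sd_generator gword set monoid" where
  "semidihedral_group n = presented_group
    {(word_power word_a (2 ^ (n - 1)), []),
     (word_power word_b 2, []),
     (word_b @ word_a @ word_b, word_power word_a (2 ^ (n - 2) - 1))}"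

section \<open>Transfer systems\<close>

definition subgroups :: "('a, 'b) monoid_scheme \<Rightarrow> 'a set set" where
  "subgroups G = {H. subgroup H G}"

definition transfer_system :: "('a, 'b) monoid_scheme \<Rightarrow> ('a set \<times> 'a set) set \<Rightarrow> bool" where
  "transfer_system G T \<longleftrightarrow>
     partial_order_on (subgroups G) T \<and>
     (\<forall>(K, H)\<in>T. K \<subseteq> H) \<and>
     (\<forall>(K, H)\<in>T. \<forall>L\<in>subgroups G. L \<subseteq> H \<longrightarrow> (K \<inter> L, H \<inter> L) \<in> T) \<and>
     (\<forall>(K, H)\<in>T. \<forall>g\<in>carrier G.
        (g <#\<^bsub>G\<^esub> K #>\<^bsub>G\<^esub> inv\<^bsub>G\<^esub> g, g <#\<^bsub>G\<^esub> H #>\<^bsub>G\<^esub> inv\<^bsub>G\<^esub> g) \<in> T)"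

definition complete_transfer_system :: "('a, 'b) monoid_scheme \<Rightarrow> ('a set \<times> 'a set) set" where
  "complete_transfer_system G = {(K, H). K \<in> subgroups G \<and> H \<in> subgroups G \<and> K \<subseteq> H}"

definition generated_transfer_system ::
    "('a, 'b) monoid_scheme \<Rightarrow> ('a set \<times> 'a set) set \<Rightarrow> ('a set \<times> 'a set) set" where
  "generated_transfer_system G S = \<Inter>{T. transfer_system G T \<and> S \<subseteq> T}"

text \<open>
  Finiteness of \<open>S\<close>, automatic for finite \<open>G\<close>, is required because \<open>card\<close> is \<open>0\<close> on infinite sets.
\<close>

definition width :: "('a, 'b) monoid_scheme \<Rightarrow> nat" where
  "width G = (LEAST k. \<exists>S. S \<subseteq> complete_transfer_system G \<and> finite S \<and> card S = k \<and>
     generated_transfer_system G S = complete_transfer_system G)"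

lemma (in group) transfer_system_complete: "transfer_system G (complete_transfer_system G)"
proof -
  have "partial_order_on (subgroups G) (complete_transfer_system G)"
    by (auto simp: partial_order_on_def preorder_on_def refl_on_def trans_def antisym_def
        complete_transfer_system_def)
  moreover have "g <# K #> inv g \<subseteq> g <# H #> inv g" if "K \<subseteq> H" for g K H
    using that by (auto simp: l_coset_def r_coset_def)
  moreover have "g <# H #> inv g \<in> subgroups G" if "H \<in> subgroups G" "g \<in> carrier G" for g H
    using that by (simp add: subgroups_def subgroup_conjugation_is_surj2)
  moreover have "K \<inter> L \<in> subgroups G" if "K \<in> subgroups G" "L \<in> subgroups G" for K L
    using that by (simp add: subgroups_def subgroups_Inter_pair)
  ultimately show ?thesis
    unfolding transfer_system_def by (simp add: complete_transfer_system_def split_def le_infI1)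
qed

lemma (in group) transfer_system_generated:
  assumes "S \<subseteq> complete_transfer_system G"
  shows "transfer_system G (generated_transfer_system G S)"
proof -
  define F where "F = {T. transfer_system G T \<and> S \<subseteq> T}"
  define I where "I = \<Inter>F"
  have I: "p \<in> I \<longleftrightarrow> (\<forall>T\<in>F. p \<in> T)" for p
    by (auto simp: I_def)
  have F: "\<forall>T\<in>F. refl_on (subgroups G) T" "\<forall>T\<in>F. trans T"
    "\<forall>T\<in>F. \<forall>(K, H)\<in>T. \<forall>L\<in>subgroups G. L \<subseteq> H \<longrightarrow> (K \<inter> L, H \<inter> L) \<in> T"
    "\<forall>T\<in>F. \<forall>(K, H)\<in>T. \<forall>g\<in>carrier G. (g <# K #> inv g, g <# H #> inv g) \<in> T"
    by (simp_all add: F_def transfer_system_def partial_order_on_def preorder_on_def)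
  have "complete_transfer_system G \<in> F"
    using assms transfer_system_complete by (simp add: F_def)
  then have sub: "I \<subseteq> complete_transfer_system G"
    unfolding I_def by (rule Inter_lower)
  have "refl_on (subgroups G) I"
    using F(1) by (simp add: refl_on_def I)
  moreover have "trans I"
  proof (rule transI)
    fix K L H assume KLH: "(K, L) \<in> I" "(L, H) \<in> I"
    have "(K, H) \<in> T" if "T \<in> F" for T
      using F(2) KLH that unfolding I by (meson transD)
    then show "(K, H) \<in> I" by (simp add: I)
  qed
  moreover have "antisym I"
    using sub by (auto simp: antisym_def complete_transfer_system_def)
  moreover have "I \<subseteq> subgroups G \<times> subgroups G" and "\<forall>(K, H)\<in>I. K \<subseteq> H"
    using sub by (auto simp: complete_transfer_system_def)
  moreover have "(K \<inter> L, H \<inter> L) \<in> I" if "(K, H) \<in> I" "L \<in> subgroups G" "L \<subseteq> H" for K H L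
    unfolding I
  proof
    fix T assume "T \<in> F"
    with F(3) that I[of "(K, H)"] show "(K \<inter> L, H \<inter> L) \<in> T" by fast
  qed
  moreover have "(g <# K #> inv g, g <# H #> inv g) \<in> I"
    if "(K, H) \<in> I" "g \<in> carrier G" for K H g
    unfolding I
  proof
    fix T assume "T \<in> F"
    with F(4) that I[of "(K, H)"] show "(g <# K #> inv g, g <# H #> inv g) \<in> T" by fast
  qed
  ultimately have "transfer_system G I"
    unfolding transfer_system_def partial_order_on_def preorder_on_def by auto
  then show ?thesis
    by (simp add: generated_transfer_system_def I_def F_def)
qed

end

theory Submission
  imports Defs "HOL-Computational_Algebra.Primes"
begin

text \<open>
  Call a proper subgroup meet-irreducible if it is not the intersection of two strictly larger
  subgroups. The width counts conjugacy classes of these. For an upper bound, the transfers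
  \<open>K \<rightarrow> G\<close> with \<open>K\<close> meet-irreducible suffice: if \<open>K \<rightarrow> G\<close> and \<open>L \<rightarrow> G\<close>, then
  \<open>K \<inter> L \<rightarrow> L \<rightarrow> G\<close> by restriction. For a lower bound, if \<open>K\<close> is meet-irreducible, then the
  pairs \<open>(L, H)\<close> with \<open>L = H\<close> or \<open>L\<close> not conjugate to \<open>K\<close> form a transfer system, so every
  generating set contains a transfer whose source is conjugate to \<open>K\<close>. In the semidihedral group
  the classes are those of \<open>\<langle>a\<rangle>\<close>, of \<open>\<langle>a^(2^k), b\<rangle>\<close> for \<open>1 \<le> k \<le> n - 1\<close>
  and of \<open>\<langle>a^(2^k), a b\<rangle>\<close> for \<open>1 \<le> k \<le> n - 2\<close>.
\<close>

section \<open>Width and meet-irreducible subgroups\<close>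

context group
begin

section \<open>Conjugation acting on subsets of the group\<close>

definition conjugate :: "'a \<Rightarrow> 'a set \<Rightarrow> 'a set" where
  "conjugate g K = (\<lambda>x. g \<otimes> x \<otimes> inv g) ` K"

lemma coset_eq_conjugate: "g <# K #> inv g = conjugate g K"
  by (auto simp: l_coset_def r_coset_def conjugate_def)

lemma conjugate_subgroup: "subgroup K G \<Longrightarrow> g \<in> carrier G \<Longrightarrow> subgroup (conjugate g K) G"
  unfolding coset_eq_conjugate[symmetric] by (rule subgroup_conjugation_is_surj2)

lemma conjugate_conjugate:
  assumes "K \<subseteq> carrier G" "g \<in> carrier G" "h \<in> carrier G"
  shows "conjugate g (conjugate h K) = conjugate (g \<otimes> h) K"
  unfolding conjugate_def image_image
  by (rule image_cong) (use assms in \<open>auto simp: m_assoc inv_mult_group subset_iff\<close>)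

lemma conjugate_one: "K \<subseteq> carrier G \<Longrightarrow> conjugate \<one> K = K"
  by (force simp: conjugate_def)

lemma conjugate_eq_iff:
  assumes "K \<subseteq> carrier G" "L \<subseteq> carrier G" "g \<in> carrier G"
  shows "conjugate g K = L \<longleftrightarrow> K = conjugate (inv g) L"
  using assms conjugate_conjugate[of K "inv g" g] conjugate_conjugate[of L g "inv g"]
  by (auto simp: conjugate_one)

lemma conjugate_Int:
  assumes "K \<subseteq> carrier G" "L \<subseteq> carrier G" "g \<in> carrier G"
  shows "conjugate g (K \<inter> L) = conjugate g K \<inter> conjugate g L"
  unfolding conjugate_def
proof (rule inj_on_image_Int[of _ "carrier G"])
  show "inj_on (\<lambda>x. g \<otimes> x \<otimes> inv g) (carrier G)"
    using assms(3) by (auto intro!: inj_onI)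
qed (use assms in auto)

lemma conjugate_subset: "K \<subseteq> carrier G \<Longrightarrow> g \<in> carrier G \<Longrightarrow> conjugate g K \<subseteq> carrier G"
  by (auto simp: conjugate_def)

lemma conjugate_carrier:
  assumes "g \<in> carrier G"
  shows "conjugate g (carrier G) = carrier G"
proof
  show "conjugate g (carrier G) \<subseteq> carrier G" using assms by (simp add: conjugate_subset)
  have "carrier G = conjugate g (conjugate (inv g) (carrier G))"
    using assms by (simp add: conjugate_conjugate conjugate_one)
  also have "\<dots> \<subseteq> conjugate g (carrier G)"
    unfolding conjugate_def[of g] using assms by (intro image_mono conjugate_subset) simp_all
  finally show "carrier G \<subseteq> conjugate g (carrier G)" .
qed

lemma mem_conjugate_iff:
  assumes "x \<in> carrier G" "K \<subseteq> carrier G" "g \<in> carrier G"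
  shows "x \<in> conjugate g K \<longleftrightarrow> inv g \<otimes> x \<otimes> g \<in> K"
proof
  assume "x \<in> conjugate g K"
  then obtain k where k: "k \<in> K" "x = g \<otimes> k \<otimes> inv g" by (auto simp: conjugate_def)
  moreover have "inv g \<otimes> (g \<otimes> k \<otimes> inv g) \<otimes> g = k"
    using assms k(1) by (simp add: m_assoc inv_solve_left' subset_iff)
  ultimately have "inv g \<otimes> x \<otimes> g = k" by simp
  then show "inv g \<otimes> x \<otimes> g \<in> K" using k by simp
next
  assume *: "inv g \<otimes> x \<otimes> g \<in> K"
  have "g \<otimes> (inv g \<otimes> x \<otimes> g) \<otimes> inv g = (g \<otimes> inv g) \<otimes> x \<otimes> (g \<otimes> inv g)"
    using assms by (simp only: m_assoc inv_closed m_closed)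
  then have "g \<otimes> (inv g \<otimes> x \<otimes> g) \<otimes> inv g = x" using assms by simp
  then show "x \<in> conjugate g K"
    unfolding conjugate_def using * by (intro image_eqI) simp_all
qed

section \<open>Meet-irreducible subgroups and transfer systems that avoid them\<close>

definition meet_irreducible :: "'a set \<Rightarrow> bool" where
  "meet_irreducible K \<longleftrightarrow> subgroup K G \<and> K \<noteq> carrier G \<and>
     (\<forall>L M. subgroup L G \<longrightarrow> subgroup M G \<longrightarrow> L \<inter> M = K \<longrightarrow> L = K \<or> M = K)"

text \<open>Conjugation by \<open>g\<close> preserves intersections and subgroups, so a
  decomposition of the conjugate pulls back along \<open>inv g\<close> to a decomposition of
  \<open>K\<close>.\<close>

lemma meet_irreducible_conjugate:
  assumes K: "meet_irreducible K" and g: "g \<in> carrier G"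
  shows "meet_irreducible (conjugate g K)"
proof -
  have sK: "subgroup K G" using K by (simp add: meet_irreducible_def)
  then have cK: "K \<subseteq> carrier G" by (rule subgroup.subset)
  have "L = conjugate g K \<or> M = conjugate g K"
    if L: "subgroup L G" and M: "subgroup M G" and LM: "L \<inter> M = conjugate g K" for L M
  proof -
    have c: "L \<subseteq> carrier G" "M \<subseteq> carrier G" using L M by (auto dest: subgroup.subset)
    have "conjugate (inv g) L \<inter> conjugate (inv g) M = conjugate (inv g) (conjugate g K)"
      using c g LM by (simp flip: conjugate_Int)
    then have "conjugate (inv g) L \<inter> conjugate (inv g) M = K"
      using cK g by (simp add: conjugate_conjugate conjugate_one)
    then have "conjugate (inv g) L = K \<or> conjugate (inv g) M = K"
      using K L M g conjugate_subgroup unfolding meet_irreducible_def by simp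
    then show ?thesis using conjugate_eq_iff c cK g by auto
  qed
  moreover have "conjugate g K \<noteq> carrier G"
    using K g cK conjugate_eq_iff[of K "carrier G" g] conjugate_carrier[of "inv g"]
    by (auto simp: meet_irreducible_def)
  ultimately show ?thesis
    using sK g conjugate_subgroup by (auto simp: meet_irreducible_def)
qed

lemma transfer_systemI:
  assumes "partial_order_on (subgroups G) T"
    and "\<And>K H. (K, H) \<in> T \<Longrightarrow> K \<subseteq> H"
    and "\<And>K H L. (K, H) \<in> T \<Longrightarrow> L \<in> subgroups G \<Longrightarrow> L \<subseteq> H \<Longrightarrow> (K \<inter> L, H \<inter> L) \<in> T"
    and "\<And>K H g. (K, H) \<in> T \<Longrightarrow> g \<in> carrier G \<Longrightarrow> (conjugate g K, conjugate g H) \<in> T"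
  shows "transfer_system G T"
  using assms unfolding transfer_system_def coset_eq_conjugate by blast

text \<open>This is the largest transfer system in which no conjugate of \<open>K\<close> is the
  source of a nontrivial transfer. Restriction is the only closure property that needs
  irreducibility: it must not produce a new transfer out of a conjugate of \<open>K\<close>.\<close>

lemma transfer_system_avoiding:
  assumes K: "meet_irreducible K"
  shows "transfer_system G {(L, H). (L, H) \<in> complete_transfer_system G \<and>
    ((\<exists>g\<in>carrier G. L = conjugate g K) \<longrightarrow> L = H)}" (is "transfer_system G ?T")
proof -
  have cK: "K \<subseteq> carrier G" using K by (auto simp: meet_irreducible_def dest: subgroup.subset)
  show ?thesis
  proof (rule transfer_systemI)
    show "partial_order_on (subgroups G) ?T"
      unfolding partial_order_on_def preorder_on_def refl_on_def trans_def antisym_def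
      by (auto simp: complete_transfer_system_def)
    show "L \<subseteq> H" if "(L, H) \<in> ?T" for L H
      using that by (auto simp: complete_transfer_system_def)
    show "(L \<inter> M, H \<inter> M) \<in> ?T"
      if LH: "(L, H) \<in> ?T" and M: "M \<in> subgroups G" "M \<subseteq> H" for L H M
    proof -
      have s: "subgroup L G" "subgroup H G" "L \<subseteq> H" "subgroup M G"
        using LH M by (simp_all add: complete_transfer_system_def subgroups_def)
      have "L \<inter> M = H \<inter> M" if g: "g \<in> carrier G" "L \<inter> M = conjugate g K" for g
      proof -
        have "meet_irreducible (conjugate g K)" using K g(1) by (rule meet_irreducible_conjugate)
        then have "L = conjugate g K \<or> M = conjugate g K"
          using s g(2) by (simp add: meet_irreducible_def)
        then show ?thesis
        proof
          assume "L = conjugate g K"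
          then have "L = H" using LH g(1) by blast
          then show ?thesis by simp
        next
          \<comment> \<open>Here \<open>M\<close> equals \<open>L \<inter> M\<close>, so it lies in
            \<open>L\<close> and in \<open>H\<close>; both restricted sides are then
            \<open>M\<close>.\<close>
          assume "M = conjugate g K"
          then show ?thesis using g(2) s(3) by blast
        qed
      qed
      then have "(\<exists>g\<in>carrier G. L \<inter> M = conjugate g K) \<longrightarrow> L \<inter> M = H \<inter> M" by blast
      moreover have "L \<inter> M \<subseteq> H \<inter> M" using s(3) by blast
      ultimately show ?thesis
        using s by (simp add: complete_transfer_system_def subgroups_def subgroups_Inter_pair)
    qed
    show "(conjugate g L, conjugate g H) \<in> ?T"
      if LH: "(L, H) \<in> ?T" and g: "g \<in> carrier G" for L H g
    proof -
      have s: "subgroup L G" "subgroup H G" "L \<subseteq> H"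
        using LH by (simp_all add: complete_transfer_system_def subgroups_def)
      have "L = H" if h: "h \<in> carrier G" "conjugate g L = conjugate h K" for h
      proof -
        have "L = conjugate (inv g) (conjugate g L)"
          using s(1) g by (simp add: conjugate_conjugate conjugate_one subgroup.subset)
        also have "\<dots> = conjugate (inv g \<otimes> h) K"
          unfolding h(2) using cK g h(1) by (simp add: conjugate_conjugate)
        finally show ?thesis using LH g h(1) by blast
      qed
      moreover have "conjugate g L \<subseteq> conjugate g H"
        unfolding conjugate_def using s(3) by (rule image_mono)
      ultimately show ?thesis
        using s g by (auto simp: complete_transfer_system_def subgroups_def conjugate_subgroup)
    qed
  qed
qed

text \<open>
  The last hypothesis says that every subgroup arises by intersecting conjugates of members of \<open>X\<close>.
\<close>

theorem width_eq_card:
  assumes fin: "finite X"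
    and irr: "\<And>K. K \<in> X \<Longrightarrow> meet_irreducible K"
    and noncon: "\<And>K L g. K \<in> X \<Longrightarrow> L \<in> X \<Longrightarrow> g \<in> carrier G \<Longrightarrow> conjugate g K = L \<Longrightarrow> K = L"
    and gen: "\<And>P K. subgroup K G \<Longrightarrow> P (carrier G) \<Longrightarrow>
      (\<And>g L. g \<in> carrier G \<Longrightarrow> L \<in> X \<Longrightarrow> P (conjugate g L)) \<Longrightarrow>
      (\<And>L M. subgroup L G \<Longrightarrow> subgroup M G \<Longrightarrow> P L \<Longrightarrow> P M \<Longrightarrow> P (L \<inter> M)) \<Longrightarrow> P K"
  shows "width G = card X"
  unfolding width_def
proof (rule Least_equality)
  let ?S = "(\<lambda>K. (K, carrier G)) ` X"
  have "subgroup K G \<and> K \<subseteq> carrier G" if "K \<in> X" for K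
    using irr[OF that] by (auto simp: meet_irreducible_def dest: subgroup.subset)
  then have SX: "?S \<subseteq> complete_transfer_system G"
    using subgroup_self by (auto simp: complete_transfer_system_def subgroups_def)
  have "complete_transfer_system G \<subseteq> T" if T: "transfer_system G T" and ST: "?S \<subseteq> T" for T
  proof
    have po: "refl_on (subgroups G) T" "trans T"
      and res: "\<And>K H L. (K, H) \<in> T \<Longrightarrow> subgroup L G \<Longrightarrow> L \<subseteq> H \<Longrightarrow> (K \<inter> L, H \<inter> L) \<in> T"
      and con: "\<And>K H g. (K, H) \<in> T \<Longrightarrow> g \<in> carrier G \<Longrightarrow> (conjugate g K, conjugate g H) \<in> T"
      using T by (auto simp: transfer_system_def partial_order_on_def preorder_on_def subgroups_def
          coset_eq_conjugate)
    \<comment> \<open>Apply \<open>gen\<close> with \<open>P K\<close> read as: \<open>K\<close>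
      transfers to the whole group.\<close>
    have top: "(K, carrier G) \<in> T" if "subgroup K G" for K
      using that
    proof (rule gen)
      show "(carrier G, carrier G) \<in> T"
        using po(1) subgroup_self by (auto simp: refl_on_def subgroups_def)
      show "(conjugate g L, carrier G) \<in> T" if "g \<in> carrier G" "L \<in> X" for g L
        using con[of L "carrier G" g] that ST by (auto simp: conjugate_carrier)
      show "(L \<inter> M, carrier G) \<in> T"
        if "subgroup L G" "subgroup M G" "(L, carrier G) \<in> T" "(M, carrier G) \<in> T" for L M
      proof -
        have "(L \<inter> M, M) \<in> T"
          using res[OF that(3,2)] subgroup.subset[OF that(2)] by (simp add: Int_absorb1)
        then show ?thesis using that(4) po(2) by (rule transD[rotated])
      qed
    qed
    fix p assume "p \<in> complete_transfer_system G"
    then obtain K H where p: "p = (K, H)" "subgroup K G" "subgroup H G" "K \<subseteq> H"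
      by (auto simp: complete_transfer_system_def subgroups_def)
    \<comment> \<open>Restricting the transfer from \<open>K\<close> to the whole group along
      \<open>H\<close> gives \<open>K\<close> to \<open>H\<close>, because \<open>K\<close> lies in
      \<open>H\<close>.\<close>
    then show "p \<in> T"
      using res[OF top[OF p(2)] p(3)] subgroup.subset[OF p(3)] by (simp add: Int_absorb1 Int_absorb2)
  qed
  then have "generated_transfer_system G ?S = complete_transfer_system G"
    using SX transfer_system_complete unfolding generated_transfer_system_def by blast
  moreover have "card ?S = card X" by (simp add: card_image inj_on_def)
  ultimately show "\<exists>S\<subseteq>complete_transfer_system G. finite S \<and> card S = card X \<and>
      generated_transfer_system G S = complete_transfer_system G"
    using SX fin by blast
next
  fix k
  assume "\<exists>S\<subseteq>complete_transfer_system G. finite S \<and> card S = k \<and>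
      generated_transfer_system G S = complete_transfer_system G"
  then obtain S where S: "S \<subseteq> complete_transfer_system G" "finite S" "card S = k"
    "generated_transfer_system G S = complete_transfer_system G" by blast
  \<comment> \<open>If no source in \<open>S\<close> were conjugate to \<open>K\<close>, the
    generated system would lie in the avoiding system of \<open>K\<close>. That system misses the
    transfer from \<open>K\<close> to the whole group, since \<open>K\<close> is proper.\<close>
  have "\<exists>p\<in>S. \<exists>g\<in>carrier G. fst p = conjugate g K" if K: "K \<in> X" for K
  proof (rule ccontr)
    let ?T = "{(L, H). (L, H) \<in> complete_transfer_system G \<and>
      ((\<exists>g\<in>carrier G. L = conjugate g K) \<longrightarrow> L = H)}"
    assume "\<not> ?thesis"
    then have "S \<subseteq> ?T" using S(1) by force
    then have "complete_transfer_system G \<subseteq> ?T"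
      using transfer_system_avoiding[OF irr[OF K]] S(4)[symmetric]
      unfolding generated_transfer_system_def by blast
    moreover have cK: "subgroup K G" "K \<noteq> carrier G" "K \<subseteq> carrier G"
      using irr[OF K] by (auto simp: meet_irreducible_def dest: subgroup.subset)
    then have "(K, carrier G) \<in> complete_transfer_system G"
      using subgroup_self by (simp add: complete_transfer_system_def subgroups_def)
    moreover have "K = conjugate \<one> K" using cK by (simp add: conjugate_one)
    ultimately show False using cK(2) by blast
  qed
  then obtain f where f: "\<And>K. K \<in> X \<Longrightarrow> f K \<in> S \<and> (\<exists>g\<in>carrier G. fst (f K) = conjugate g K)"
    by metis
  \<comment> \<open>One pair cannot serve two members of \<open>X\<close>: its source would be
    conjugate to both, against \<open>noncon\<close>.\<close>
  have "inj_on f X"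
  proof (rule inj_onI)
    fix K L assume KL: "K \<in> X" "L \<in> X" "f K = f L"
    then obtain g h where gh: "g \<in> carrier G" "h \<in> carrier G" "conjugate g K = conjugate h L"
      using f by metis
    have c: "K \<subseteq> carrier G" "L \<subseteq> carrier G"
      using irr[OF KL(1)] irr[OF KL(2)] by (auto simp: meet_irreducible_def dest: subgroup.subset)
    have "conjugate (inv h \<otimes> g) K = conjugate (inv h) (conjugate h L)"
      using gh c by (simp flip: gh(3) add: conjugate_conjugate)
    also have "\<dots> = L" using gh c by (simp add: conjugate_conjugate conjugate_one)
    finally show "K = L" by (rule noncon[OF KL(1,2), rotated]) (use gh in simp)
  qed
  moreover have "f ` X \<subseteq> S" using f by blast
  ultimately show "card X \<le> k" using S card_inj_on_le by metis
qed

end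

section \<open>Subgroups of semidihedral groups\<close>

text \<open>The element \<open>el i e\<close> is \<open>a\<^sup>i\<close> for \<open>e = False\<close> and \<open>a\<^sup>i b\<close> for \<open>e = True\<close>.\<close>

locale semidihedral = group G for G (structure) +
  fixes n :: nat and el :: "int \<Rightarrow> bool \<Rightarrow> 'a"
  assumes n_ge: "n \<ge> 4"
    and carrier_eq: "carrier G = {el i e |i e. True}"
    and el_mult: "el i e \<otimes> el j f = el (if e then i + (2 ^ (n - 2) - 1) * j else i + j) (e \<noteq> f)"
    and el_eq_iff: "el i e = el j f \<longleftrightarrow> e = f \<and> 2 ^ (n - 1) dvd i - j"
begin

section \<open>Inverses and conjugates of the elements a^i b^e\<close>

lemma el_carrier [simp]: "el i e \<in> carrier G"
  by (auto simp: carrier_eq)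

lemma carrier_elE:
  assumes "x \<in> carrier G"
  obtains i e where "x = el i e"
  using assms unfolding carrier_eq by blast

text \<open>With Q = 2^(n-3), the twist is 2Q - 1 and the modulus of the exponents is 4Q. That Q is
  even is where \<open>n \<ge> 4\<close> enters.\<close>

lemma power_eqs:
  "(2::int) ^ (n - 2) = 2 * 2 ^ (n - 3)" "(2::int) ^ (n - 1) = 4 * 2 ^ (n - 3)" "even ((2::int) ^ (n - 3))"
proof -
  obtain m where "n = m + 4" using n_ge by (metis add.commute le_Suc_ex)
  then show "(2::int) ^ (n - 2) = 2 * 2 ^ (n - 3)" "(2::int) ^ (n - 1) = 4 * 2 ^ (n - 3)"
    "even ((2::int) ^ (n - 3))" by (simp_all add: eval_nat_numeral)
qed

lemma one_eq: "\<one> = el 0 False"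
  using el_mult[of 0 False 0 False] r_cancel_one[of "el 0 False" "el 0 False"] by simp

lemma inv_el_False: "inv (el i False) = el (- i) False"
  by (rule inv_equality) (simp_all add: el_mult one_eq)

lemma inv_el_True: "inv (el i True) = el (- ((2 ^ (n - 2) - 1) * i)) True"
proof (rule inv_equality)
  show "el (- ((2 ^ (n - 2) - 1) * i)) True \<otimes> el i True = \<one>"
    by (simp add: el_mult one_eq)
qed simp_all

text \<open>The multiplier is 1 or the twist 2^(n-2) - 1. Only its oddness is recorded, since
  multiplying by an odd number does not change divisibility by powers of two.\<close>

lemma conj_rotation:
  "\<exists>s. odd s \<and> (\<forall>x. inv (el y e) \<otimes> el x False \<otimes> el y e = el (s * x) False)"
proof (cases e)
  case True
  have "odd ((2::int) ^ (n - 2) - 1)" by (simp add: power_eqs)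
  then show ?thesis using True
    by (intro exI[of _ "2 ^ (n - 2) - 1"]) (simp add: inv_el_True el_mult algebra_simps)
next
  case False
  then show ?thesis by (intro exI[of _ 1]) (simp add: inv_el_False el_mult)
qed

text \<open>Conjugation moves the exponent of a reflection by a multiple of 2^(n-2) - 2, which is
  even. So parity is a conjugacy invariant, and it separates the class of b from that of ab.\<close>

lemma conj_reflection_parity:
  "\<exists>z. inv (el y e) \<otimes> el x True \<otimes> el y e = el z True \<and> even (z - x)"
  by (cases e) (auto simp: inv_el_False inv_el_True el_mult power_eqs)

section \<open>The subgroups <a^(2^k)> and <a^(2^k), a^i b>\<close>

definition rot :: "nat \<Rightarrow> 'a set" where
  "rot k = {el x False |x. 2 ^ k dvd x}"

text \<open>The union of <a^(2^k)> with its coset through a^i b. It is a subgroup only under the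
  condition in \<open>subgroup_dih\<close>, and can then be dihedral, quaternion, semidihedral or
  small and abelian.\<close>

definition dih :: "nat \<Rightarrow> int \<Rightarrow> 'a set" where
  "dih k i = rot k \<union> {el x True |x. 2 ^ k dvd x - i}"

lemma rot_dih_carrier: "rot k \<subseteq> carrier G" "dih k i \<subseteq> carrier G"
  by (auto simp: rot_def dih_def)

lemma power2_dvd_cong:
  assumes "k \<le> n - 1" "2 ^ (n - 1) dvd x - y"
  shows "2 ^ k dvd x \<longleftrightarrow> (2::int) ^ k dvd y"
proof -
  have "2 ^ k dvd x - y" using assms le_imp_power_dvd dvd_trans by blast
  from dvd_add_right_iff[OF this, of y] show ?thesis by simp
qed

lemma power2_dvd_one_iff: "(2::int) ^ k dvd 1 \<longleftrightarrow> k = 0"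
  by (simp only: is_unit_power_iff) simp

text \<open>An element determines its exponent only modulo 2^(n-1). For \<open>k \<le> n - 1\<close>
  divisibility by 2^k does not depend on the representative, which makes the membership tests for
  \<open>rot\<close> and \<open>dih\<close> computable.\<close>

lemma ex_cong_dvd_iff:
  assumes "k \<le> n - 1"
  shows "(\<exists>y. 2 ^ (n - 1) dvd x - y \<and> 2 ^ k dvd y - i) \<longleftrightarrow> (2::int) ^ k dvd x - i"
proof
  assume "\<exists>y. 2 ^ (n - 1) dvd x - y \<and> 2 ^ k dvd y - i"
  then obtain y where y: "2 ^ (n - 1) dvd x - y" "2 ^ k dvd y - i" by (elim exE conjE)
  have "2 ^ (n - 1) dvd (x - i) - (y - i)" using y(1) by simp
  from power2_dvd_cong[OF assms this] y(2) show "2 ^ k dvd x - i" by (rule iffD2)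
next
  assume "2 ^ k dvd x - i"
  then show "\<exists>y. 2 ^ (n - 1) dvd x - y \<and> 2 ^ k dvd y - i" by (intro exI[of _ x]) simp
qed

lemma mem_rot:
  assumes "k \<le> n - 1"
  shows "el x e \<in> rot k \<longleftrightarrow> \<not> e \<and> 2 ^ k dvd x"
proof -
  have "el x e \<in> rot k \<longleftrightarrow> \<not> e \<and> (\<exists>y. 2 ^ (n - 1) dvd x - y \<and> 2 ^ k dvd y - 0)"
    unfolding rot_def mem_Collect_eq el_eq_iff by simp
  then show ?thesis unfolding ex_cong_dvd_iff[OF assms] by simp
qed

lemma mem_dih:
  assumes "k \<le> n - 1"
  shows "el x e \<in> dih k i \<longleftrightarrow> 2 ^ k dvd (if e then x - i else x)"
proof -
  have "el x e \<in> dih k i \<longleftrightarrow>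
      el x e \<in> rot k \<or> e \<and> (\<exists>y. 2 ^ (n - 1) dvd x - y \<and> 2 ^ k dvd y - i)"
    unfolding dih_def Un_iff mem_Collect_eq el_eq_iff by simp
  then show ?thesis unfolding ex_cong_dvd_iff[OF assms] mem_rot[OF assms] by simp
qed

lemma set_eqI_el:
  assumes "A \<subseteq> carrier G" "B \<subseteq> carrier G" "\<And>x e. el x e \<in> A \<longleftrightarrow> el x e \<in> B"
  shows "A = B"
proof (intro Set.set_eqI)
  fix z
  show "z \<in> A \<longleftrightarrow> z \<in> B"
  proof (cases "z \<in> carrier G")
    case True
    then show ?thesis using assms(3) by (elim carrier_elE) simp
  next
    case False
    then show ?thesis using assms(1,2) by blast
  qed
qed

lemma dih_0: "dih 0 i = carrier G"
  by (rule set_eqI_el) (simp_all add: rot_dih_carrier mem_dih)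

lemma subgroup_rot:
  assumes k: "k \<le> n - 1"
  shows "subgroup (rot k) G"
proof
  show "\<one> \<in> rot k" using k by (simp add: one_eq mem_rot)
  show "x \<otimes> y \<in> rot k" if xy: "x \<in> rot k" "y \<in> rot k" for x y
  proof -
    obtain p q where p: "x = el p False" "2 ^ k dvd p" and q: "y = el q False" "2 ^ k dvd q"
      using xy unfolding rot_def by blast
    have "2 ^ k dvd p + q" using p(2) q(2) by (rule dvd_add)
    then show ?thesis unfolding p q el_mult using k by (simp add: mem_rot)
  qed
  show "inv x \<in> rot k" if x: "x \<in> rot k" for x
  proof -
    obtain p where p: "x = el p False" "2 ^ k dvd p" using x unfolding rot_def by blast
    then show ?thesis unfolding p(1) inv_el_False using k by (simp add: mem_rot)
  qed
qed (rule rot_dih_carrier)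

text \<open>The square of a^i b is a^(2^(n-2) i), so the second hypothesis says that this square
  lies in the rotation part. It is restrictive only for \<open>k = n - 1\<close> and odd
  \<open>i\<close>.\<close>

lemma subgroup_dih:
  assumes k: "k \<le> n - 1" and i: "2 ^ k dvd 2 ^ (n - 2) * i"
  shows "subgroup (dih k i) G"
proof
  show "\<one> \<in> dih k i" using k by (simp add: one_eq mem_dih)
  \<comment> \<open>The condition on squares passes from \<open>i\<close> to every reflection in the
    same coset.\<close>
  have *: "2 ^ k dvd 2 ^ (n - 2) * x" if "2 ^ k dvd x - i" for x
    using dvd_add[OF dvd_mult[OF that, of "2 ^ (n - 2)"] i] by (simp add: right_diff_distrib)
  show "x \<otimes> y \<in> dih k i" if xy: "x \<in> dih k i" "y \<in> dih k i" for x y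
  proof -
    obtain p e where p: "x = el p e" by (rule carrier_elE[OF subsetD[OF rot_dih_carrier(2) xy(1)]])
    obtain q f where q: "y = el q f" by (rule carrier_elE[OF subsetD[OF rot_dih_carrier(2) xy(2)]])
    note pq = p q
    have d: "2 ^ k dvd (if e then p - i else p)" "2 ^ k dvd (if f then q - i else q)"
      using xy k unfolding pq by (simp_all add: mem_dih)
    show ?thesis
    proof (cases e; cases f)
      assume e: "e" "f"
      \<comment> \<open>The product of two reflections is a rotation with exponent p + (2^(n-2) - 1)
        q; this is the same number, rearranged.\<close>
      then have "2 ^ k dvd (p - i) - (q - i) + 2 ^ (n - 2) * q"
        using dvd_add[OF dvd_diff[of "2 ^ k" "p - i" "q - i"] *[of q]] d e by simp
      then show ?thesis using e k by (simp add: pq el_mult mem_dih algebra_simps)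
    next
      assume e: "e" "\<not> f"
      then have "2 ^ k dvd (p - i) + (2 ^ (n - 2) - 1) * q"
        using d by (intro dvd_add dvd_mult) simp_all
      then show ?thesis using e k by (simp add: pq el_mult mem_dih algebra_simps)
    next
      assume e: "\<not> e" "f"
      then have "2 ^ k dvd p + (q - i)"
        using d by (intro dvd_add) simp_all
      then show ?thesis using e k by (simp add: pq el_mult mem_dih algebra_simps)
    next
      assume e: "\<not> e" "\<not> f"
      then have "2 ^ k dvd p + q"
        using d by (intro dvd_add) simp_all
      then show ?thesis using e k by (simp add: pq el_mult mem_dih)
    qed
  qed
  show "inv x \<in> dih k i" if x: "x \<in> dih k i" for x
  proof -
    obtain p e where p: "x = el p e" by (rule carrier_elE[OF subsetD[OF rot_dih_carrier(2) x]])
    show ?thesis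
    proof (cases e)
      case True
      then have "2 ^ k dvd p - i" using p x k by (simp add: mem_dih)
      from dvd_diff[OF this *[OF this]] have "2 ^ k dvd (p - i) - 2 ^ (n - 2) * p" .
      then show ?thesis using p True k by (simp add: inv_el_True mem_dih algebra_simps)
    next
      case False
      then show ?thesis using p x k by (simp add: inv_el_False mem_dih)
    qed
  qed
qed (rule rot_dih_carrier)

section \<open>Classification of all subgroups\<close>

lemma subgroup_rotations:
  assumes H: "subgroup H G"
  shows "\<exists>k\<le>n - 1. \<forall>x. el x False \<in> H \<longleftrightarrow> 2 ^ k dvd x"
proof -
  \<comment> \<open>The exponents of rotations in \<open>H\<close> form a subgroup of the integers
    containing 2^(n-1). Its generator is therefore a power of two, and the smallest power of two in
    it is that generator.\<close>
  define k where "k = (LEAST k. el (2 ^ k) False \<in> H)"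
  have "el (2 ^ (n - 1)) False = \<one>" by (simp add: one_eq el_eq_iff)
  then have top: "el (2 ^ (n - 1)) False \<in> H" using subgroup.one_closed[OF H] by simp
  then have k: "k \<le> n - 1" "el (2 ^ k) False \<in> H"
    unfolding k_def by (rule Least_le, rule LeastI)
  have mult: "el (c * x) False \<in> H" if x: "el x False \<in> H" for c x
  proof (induction c rule: int_induct[where k = 0])
    case base
    show ?case using subgroup.one_closed[OF H] by (simp add: one_eq)
  next
    case (step1 c)
    then show ?case using subgroup.m_closed[OF H step1(2) x] by (simp add: el_mult algebra_simps)
  next
    case (step2 c)
    then show ?case using subgroup.m_closed[OF H step2(2) subgroup.m_inv_closed[OF H x]]
      by (simp add: inv_el_False el_mult algebra_simps)
  qed
  have "2 ^ k dvd x" if x: "el x False \<in> H" for x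
  proof -
    \<comment> \<open>Bezout puts the gcd of \<open>x\<close> and 2^(n-1) among the exponents, and
      as a divisor of 2^(n-1) it is a power of two, hence comparable with 2^k.\<close>
    obtain j where j: "gcd x (2 ^ (n - 1)) = 2 ^ j"
      using divides_primepow[of "2::int" "gcd x (2 ^ (n - 1))" "n - 1"] by auto
    obtain u v where "u * x + v * 2 ^ (n - 1) = 2 ^ j"
      using bezout_int[of x "2 ^ (n - 1)"] unfolding j by blast
    then have "el (2 ^ j) False \<in> H"
      using subgroup.m_closed[OF H mult[OF x, of u] mult[OF top, of v]] by (simp add: el_mult)
    then have "k \<le> j" unfolding k_def by (rule Least_le)
    then have "2 ^ k dvd (2::int) ^ j" by (rule le_imp_power_dvd)
    also have "\<dots> dvd x" by (simp flip: j)
    finally show ?thesis .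
  qed
  moreover have "el x False \<in> H" if "2 ^ k dvd x" for x
    using that mult[OF k(2)] by (auto simp: dvd_def mult.commute)
  ultimately show ?thesis using k(1) by blast
qed

text \<open>Multiplication by the given reflection matches the rotations in \<open>H\<close> with
  its reflections, so \<open>k\<close> and \<open>i\<close> determine \<open>H\<close>. The
  divisibility comes from squaring that reflection.\<close>

lemma subgroup_with_reflection:
  assumes H: "subgroup H G" and i: "el i True \<in> H"
  obtains k where "k \<le> n - 1" "H = dih k i" "2 ^ k dvd 2 ^ (n - 2) * i"
proof -
  obtain k where "k \<le> n - 1 \<and> (\<forall>x. el x False \<in> H \<longleftrightarrow> 2 ^ k dvd x)"
    using subgroup_rotations[OF H] by (rule exE)
  then have k: "k \<le> n - 1" "\<And>x. el x False \<in> H \<longleftrightarrow> 2 ^ k dvd x" by simp_all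
  have "el x True \<in> H \<longleftrightarrow> el (x - i) False \<in> H" for x
  proof
    assume "el (x - i) False \<in> H"
    from subgroup.m_closed[OF H this i] show "el x True \<in> H" by (simp add: el_mult)
  next
    assume x: "el x True \<in> H"
    have "el x True = el (x - i) False \<otimes> el i True" by (simp add: el_mult)
    then have "el x True \<otimes> inv (el i True) = el (x - i) False" by (simp add: m_assoc)
    then show "el (x - i) False \<in> H"
      using subgroup.m_closed[OF H x subgroup.m_inv_closed[OF H i]] by simp
  qed
  then have "el x e \<in> H \<longleftrightarrow> el x e \<in> dih k i" for x e
    using k by (cases e) (simp_all add: mem_dih)
  then have "H = dih k i" by (rule set_eqI_el[OF subgroup.subset[OF H] rot_dih_carrier(2)])
  moreover have "2 ^ k dvd 2 ^ (n - 2) * i"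
    using subgroup.m_closed[OF H i i] k(2) by (simp add: el_mult algebra_simps)
  ultimately show thesis using k(1) by (intro that)
qed

lemma subgroup_without_reflection:
  assumes H: "subgroup H G" and i: "\<And>i. el i True \<notin> H"
  obtains k where "k \<le> n - 1" "H = rot k"
proof -
  obtain k where "k \<le> n - 1 \<and> (\<forall>x. el x False \<in> H \<longleftrightarrow> 2 ^ k dvd x)"
    using subgroup_rotations[OF H] by (rule exE)
  then have k: "k \<le> n - 1" "\<And>x. el x False \<in> H \<longleftrightarrow> 2 ^ k dvd x" by simp_all
  have "el x e \<in> H \<longleftrightarrow> el x e \<in> rot k" for x e
    using k i by (cases e) (simp_all add: mem_rot)
  then have "H = rot k" by (rule set_eqI_el[OF subgroup.subset[OF H] rot_dih_carrier(1)])
  then show thesis using k(1) by (intro that)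
qed

section \<open>The meet-irreducible subgroups\<close>

lemma meet_irreducible_rot_0: "meet_irreducible (rot 0)"
proof -
  \<comment> \<open><a> is maximal: an overgroup contains a, so the parameter \<open>k\<close> of
    its rotation part is 0.\<close>
  have over: "L = rot 0 \<or> L = carrier G" if L: "subgroup L G" "rot 0 \<subseteq> L" for L
  proof -
    have one: "el 1 False \<in> L" by (rule subsetD[OF L(2)]) (simp add: mem_rot)
    show ?thesis
    proof (cases "\<exists>i. el i True \<in> L")
      case True
      then obtain i where i: "el i True \<in> L" by blast
      obtain k where k: "k \<le> n - 1" "L = dih k i"
        by (rule subgroup_with_reflection[OF L(1) i])
      then have "k = 0" using one by (simp add: mem_dih power2_dvd_one_iff del: zdvd1_eq)
      then show ?thesis using k dih_0 by simp
    next
      case False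
      then have i: "el i True \<notin> L" for i by simp
      obtain k where k: "k \<le> n - 1" "L = rot k"
        by (rule subgroup_without_reflection[OF L(1) i])
      then have "k = 0" using one by (simp add: mem_rot power2_dvd_one_iff del: zdvd1_eq)
      then show ?thesis using k by simp
    qed
  qed
  have ne: "rot 0 \<noteq> carrier G"
  proof
    assume "rot 0 = carrier G"
    then show False using el_carrier[of 0 True] mem_rot[of 0 0 True] by simp
  qed
  show ?thesis
    unfolding meet_irreducible_def
  proof (intro conjI allI impI ne)
    show "subgroup (rot 0) G" by (rule subgroup_rot) simp
    fix L M assume LM: "subgroup L G" "subgroup M G" "L \<inter> M = rot 0"
    have "rot 0 \<subseteq> L" "rot 0 \<subseteq> M" unfolding LM(3)[symmetric] by simp_all
    then consider "L = rot 0" | "M = rot 0" | "L = carrier G" "M = carrier G"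
      using over LM(1,2) by metis
    then show "L = rot 0 \<or> M = rot 0"
      using LM(3) ne by cases simp_all
  qed
qed

text \<open>The overgroups of \<open>dih k i\<close> are the \<open>dih l i\<close> with \<open>l \<le> k\<close>, which form a chain.\<close>

lemma meet_irreducible_dih:
  assumes k: "0 < k" "k \<le> n - 1" and i: "2 ^ k dvd 2 ^ (n - 2) * i"
  shows "meet_irreducible (dih k i)"
  unfolding meet_irreducible_def
proof (intro conjI allI impI)
  show "subgroup (dih k i) G" using k i by (intro subgroup_dih)
  have "el 1 False \<notin> dih k i" using k by (simp add: mem_dih power2_dvd_one_iff del: zdvd1_eq)
  then show "dih k i \<noteq> carrier G" by (rule contrapos_nn) simp
  fix L M assume L: "subgroup L G" and M: "subgroup M G" and LM: "L \<inter> M = dih k i"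
  have "el i True \<in> L \<inter> M" unfolding LM using k by (simp add: mem_dih)
  then have iLM: "el i True \<in> L" "el i True \<in> M" by simp_all
  obtain l where l: "l \<le> n - 1" "L = dih l i" by (rule subgroup_with_reflection[OF L iLM(1)])
  obtain m where m: "m \<le> n - 1" "M = dih m i" by (rule subgroup_with_reflection[OF M iLM(2)])
  \<comment> \<open>Comparing the rotations in \<open>L\<close>, \<open>M\<close> and their
    intersection will give \<open>k = max l m\<close>; the test values are the two sides of this
    equation, as exponents of 2.\<close>
  have dvd: "2 ^ l dvd x \<and> 2 ^ m dvd x \<longleftrightarrow> 2 ^ k dvd x" for x :: int
  proof -
    have "el x False \<in> dih l i \<and> el x False \<in> dih m i \<longleftrightarrow> el x False \<in> dih k i"
      unfolding LM[symmetric] l(2) m(2) by simp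
    then show ?thesis unfolding mem_dih[OF l(1)] mem_dih[OF m(1)] mem_dih[OF k(2)] by simp
  qed
  have "2 ^ k dvd (2::int) ^ max l m" by (simp add: le_imp_power_dvd flip: dvd)
  moreover have "2 ^ l dvd (2::int) ^ k" "2 ^ m dvd (2::int) ^ k" using dvd[of "2 ^ k"] by simp_all
  ultimately have "k \<le> max l m" "l \<le> k" "m \<le> k" by (simp_all add: dvd_power_iff)
  then have "l = k \<or> m = k" by linarith
  then show "L = dih k i \<or> M = dih k i" unfolding l(2) m(2) by (elim disjE) simp_all
qed

section \<open>Conjugacy classes of the subgroups containing reflections\<close>

lemma dih_conjugate_invariant:
  assumes k: "0 < k" "k \<le> n - 1" "0 < l" "l \<le> n - 1" and g: "g \<in> carrier G"
    and eq: "conjugate g (dih k i) = dih l j"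
  shows "k = l" "even (j - i)"
proof -
  obtain y e where y: "g = el y e" by (rule carrier_elE[OF g])
  have mem: "x \<in> dih l j \<longleftrightarrow> inv g \<otimes> x \<otimes> g \<in> dih k i" if "x \<in> carrier G" for x
    using mem_conjugate_iff[OF that rot_dih_carrier(2) g, of k i] by (simp add: eq)
  obtain s where s: "odd s" "\<And>x. inv g \<otimes> el x False \<otimes> g = el (s * x) False"
    using conj_rotation[of y e] unfolding y by blast
  have "coprime (2 ^ k) s" using s(1) by simp
  \<comment> \<open>An odd multiplier is invisible to powers of two, so the rotation parts
    agree.\<close>
  then have dvd: "2 ^ l dvd x \<longleftrightarrow> 2 ^ k dvd x" for x :: int
    using mem[OF el_carrier, of x False]
    unfolding s(2) mem_dih[OF k(2)] mem_dih[OF k(4)] by (simp add: coprime_dvd_mult_right_iff)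
  have "2 ^ l dvd (2::int) ^ k" "2 ^ k dvd (2::int) ^ l" by (simp add: dvd, simp flip: dvd)
  then show "k = l" by (simp_all add: dvd_power_iff)
  obtain z where z: "inv g \<otimes> el j True \<otimes> g = el z True" "even (z - j)"
    using conj_reflection_parity[of y e j] unfolding y by blast
  have "el z True \<in> dih k i"
    using mem[OF el_carrier, of j True] unfolding z(1) mem_dih[OF k(4)] by simp
  then have "2 ^ k dvd z - i" using k by (simp add: mem_dih)
  \<comment> \<open>Since \<open>k\<close> is positive, all reflections in \<open>dih k i\<close>
    have exponents of the parity of \<open>i\<close>.\<close>
  then have "even (z - i)" by (rule dvd_trans[rotated]) (use k(1) in simp)
  then show "even (j - i)" using z(2) by presburger
qed

text \<open>Conjugation sends reflections to reflections; <a> contains none, while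
  \<open>dih k i\<close> contains a^i b.\<close>

lemma rot_0_conjugate_dih:
  assumes "g \<in> carrier G"
  shows "conjugate g (rot 0) \<noteq> dih k i" "conjugate g (dih k i) \<noteq> rot 0"
proof -
  have *: "conjugate h (rot 0) \<noteq> dih k i" if h: "h \<in> carrier G" for h
  proof -
    obtain y e where y: "h = el y e" by (rule carrier_elE[OF h])
    obtain z where "inv h \<otimes> el i True \<otimes> h = el z True"
      using conj_reflection_parity[of y e i] y by blast
    then have "el i True \<notin> conjugate h (rot 0)"
      using h by (simp add: mem_conjugate_iff rot_dih_carrier mem_rot)
    moreover have "el i True \<in> dih k i" by (auto simp: dih_def)
    ultimately show ?thesis by blast
  qed
  show "conjugate g (rot 0) \<noteq> dih k i" using assms by (rule *)
  show "conjugate g (dih k i) \<noteq> rot 0"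
    using *[of "inv g"] assms conjugate_eq_iff[of "dih k i" "rot 0" g] rot_dih_carrier by auto
qed

lemma dih_conjugate:
  assumes k: "k \<le> n - 1" and ij: "even (i - j)"
  obtains g where "g \<in> carrier G" "dih k i = conjugate g (dih k j)"
proof -
  obtain d where d: "i - j = 2 * d" using ij by blast
  define Q :: int where "Q = 2 ^ (n - 3)"
  obtain q where q: "Q = 2 * q" using power_eqs(3) unfolding Q_def by blast
  \<comment> \<open>Conjugation by a^y shifts the index by (2 - 2Q) y, so (1 - Q) y must be
    congruent to d modulo 2Q. As Q is even, 2Q divides Q^2, and 1 + Q is inverse to 1 - Q modulo
    2Q.\<close>
  define y where "y = (1 + Q) * d"
  have "el x e \<in> dih k i \<longleftrightarrow> inv (el y False) \<otimes> el x e \<otimes> el y False \<in> dih k j" for x e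
  proof (cases e)
    case True
    have "(x - i) - (x + (2 ^ (n - 2) - 2) * y - j) = 2 ^ (n - 1) * (- q * d)"
      using d unfolding y_def power_eqs Q_def[symmetric] q by (simp add: algebra_simps)
    then have "2 ^ (n - 1) dvd (x - i) - (x + (2 ^ (n - 2) - 2) * y - j)" by simp
    from power2_dvd_cong[OF k this] show ?thesis
      using True k by (simp add: inv_el_False el_mult mem_dih algebra_simps)
  next
    case False
    then show ?thesis using k by (simp add: inv_el_False el_mult mem_dih)
  qed
  then have "dih k i = conjugate (el y False) (dih k j)"
    by (intro set_eqI_el) (simp_all add: mem_conjugate_iff rot_dih_carrier conjugate_subset)
  then show thesis by (rule that[rotated]) simp
qed

text \<open>One pair per conjugacy class of proper subgroups containing a reflection. The value
  \<open>k = 0\<close> would give the whole group. The pair \<open>(n - 1, 1)\<close> is absent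
  because the square of ab is a^(2^(n-2)), which is not trivial.\<close>

definition index_set :: "(nat \<times> int) set" where
  "index_set = {1..n - 1} \<times> {0} \<union> {1..n - 2} \<times> {1}"

lemma index_setD:
  assumes "p \<in> index_set"
  shows "0 < fst p" "fst p \<le> n - 1" "2 ^ fst p dvd 2 ^ (n - 2) * snd p"
proof -
  from assms have "p \<in> {1..n - 1} \<times> {0} \<or> p \<in> {1..n - 2} \<times> {1}"
    by (simp only: index_set_def Un_iff)
  then have "0 < fst p \<and> fst p \<le> n - 1 \<and> 2 ^ fst p dvd 2 ^ (n - 2) * snd p"
    by (elim disjE) (auto simp: le_imp_power_dvd)
  then show "0 < fst p" "fst p \<le> n - 1" "2 ^ fst p dvd 2 ^ (n - 2) * snd p" by simp_all
qed

lemma index_set_conjugate: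
  assumes "p \<in> index_set" "q \<in> index_set" "g \<in> carrier G"
    and "conjugate g (case_prod dih p) = case_prod dih q"
  shows "p = q"
proof -
  have "fst p = fst q \<and> even (snd q - snd p)"
    using dih_conjugate_invariant[OF index_setD(1,2)[OF assms(1)] index_setD(1,2)[OF assms(2)] assms(3)]
      assms(4) by (simp add: split_beta)
  moreover have "snd p = 0 \<or> snd p = 1" "snd q = 0 \<or> snd q = 1"
    using assms(1,2) by (auto simp: index_set_def)
  ultimately show ?thesis by (elim disjE) (simp_all add: prod_eq_iff)
qed

lemma inj_on_dih: "inj_on (case_prod dih) index_set"
proof (rule inj_onI)
  fix p q assume pq: "p \<in> index_set" "q \<in> index_set" "case_prod dih p = case_prod dih q"
  have "conjugate \<one> (case_prod dih p) = case_prod dih q"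
    unfolding pq(3) by (simp add: split_beta conjugate_one rot_dih_carrier)
  then show "p = q" by (rule index_set_conjugate[OF pq(1,2) one_closed])
qed

lemma card_index_set: "finite index_set" "card index_set = 2 * n - 3"
proof -
  have "({1..n - 1} \<times> {0 :: int}) \<inter> ({1..n - 2} \<times> {1}) = {}" by auto
  then have "card index_set = (n - 1) + (n - 2)"
    unfolding index_set_def by (subst card_Un_disjoint) (simp_all add: card_cartesian_product)
  then show "card index_set = 2 * n - 3" using n_ge by simp
qed (simp add: index_set_def)

lemma dih_conjugate_representative:
  assumes k: "0 < k" "k \<le> n - 1" and i: "2 ^ k dvd 2 ^ (n - 2) * i"
  obtains g p where "g \<in> carrier G" "p \<in> index_set" "dih k i = conjugate g (case_prod dih p)"
proof -
  \<comment> \<open>For odd \<open>i\<close> the square of a^i b has exponent exactly divisible by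
    2^(n-2), which excludes \<open>k = n - 1\<close>.\<close>
  have "k \<le> n - 2" if "odd i"
  proof -
    have "coprime (2 ^ k) i" using that by simp
    then have "2 ^ k dvd (2::int) ^ (n - 2)" using i by (simp add: coprime_dvd_mult_left_iff)
    then show ?thesis by (simp add: dvd_power_iff)
  qed
  then have "(k, i mod 2) \<in> index_set"
    using k by (cases "even i") (simp_all add: index_set_def odd_iff_mod_2_eq_one)
  moreover have "even (i - i mod 2)" by simp
  then obtain g where "g \<in> carrier G" "dih k i = conjugate g (dih k (i mod 2))"
    by (rule dih_conjugate[OF k(2)])
  ultimately show thesis using that[of g "(k, i mod 2)"] by simp
qed

theorem width_eq: "width G = 2 * n - 2"
proof -
  let ?X = "insert (rot 0) (case_prod dih ` index_set)"
  have "width G = card ?X"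
  proof (rule width_eq_card)
    show "finite ?X" using card_index_set(1) by simp
    show "meet_irreducible K" if "K \<in> ?X" for K
      using that meet_irreducible_rot_0 meet_irreducible_dih[OF index_setD]
      by (auto simp: split_beta)
    show "K = L" if K: "K \<in> ?X" and L: "L \<in> ?X" and g: "g \<in> carrier G" "conjugate g K = L" for K L g
      using K
    proof
      assume K0: "K = rot 0"
      show ?thesis using L
      proof
        assume "L \<in> case_prod dih ` index_set"
        then show ?thesis using rot_0_conjugate_dih(1)[OF g(1)] g(2) K0 by auto
      qed (simp add: K0)
    next
      assume K1: "K \<in> case_prod dih ` index_set"
      show ?thesis using L
      proof
        assume "L = rot 0"
        then show ?thesis using rot_0_conjugate_dih(2)[OF g(1)] g(2) K1 by auto
      next
        assume "L \<in> case_prod dih ` index_set"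
        then obtain p q where "p \<in> index_set" "q \<in> index_set" "K = case_prod dih p" "L = case_prod dih q"
          using K1 by blast
        then show ?thesis using index_set_conjugate[of p q g] g by simp
      qed
    qed
    fix P K
    assume K: "subgroup K G" and top: "P (carrier G)"
      and conj: "\<And>g L. g \<in> carrier G \<Longrightarrow> L \<in> ?X \<Longrightarrow> P (conjugate g L)"
      and Int: "\<And>L M. subgroup L G \<Longrightarrow> subgroup M G \<Longrightarrow> P L \<Longrightarrow> P M \<Longrightarrow> P (L \<inter> M)"
    have dih: "P (dih k i)" if k: "k \<le> n - 1" and i: "2 ^ k dvd 2 ^ (n - 2) * i" for k i
    proof (cases "k = 0")
      case True
      then show ?thesis using top by (simp add: dih_0)
    next
      case False
      then have "0 < k" by simp
      then obtain g p where "g \<in> carrier G" "p \<in> index_set" "dih k i = conjugate g (case_prod dih p)"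
        by (rule dih_conjugate_representative[OF _ k i])
      then show ?thesis using conj[of g "case_prod dih p"] by simp
    qed
    have rot: "P (rot k)" if k: "k \<le> n - 1" for k
    proof -
      \<comment> \<open>The remaining rotation subgroups are intersections of <a> with a
        \<open>dih\<close>; index 0 meets the subgroup condition for every \<open>k\<close>.\<close>
      have "rot 0 \<inter> dih k 0 = rot k"
        by (rule set_eqI_el) (simp_all add: mem_rot[of 0] mem_rot[OF k] mem_dih[OF k] rot_dih_carrier le_infI2)
      moreover have "P (rot 0)"
        using conj[OF one_closed, of "rot 0"] by (simp add: conjugate_one rot_dih_carrier)
      then have "P (rot 0 \<inter> dih k 0)"
        using k by (intro Int dih subgroup_rot subgroup_dih) simp_all
      ultimately show ?thesis by simp
    qed
    show "P K"
    proof (cases "\<exists>i. el i True \<in> K")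
      case True
      then obtain i where i: "el i True \<in> K" by (rule exE)
      obtain k where "k \<le> n - 1" "K = dih k i" "2 ^ k dvd 2 ^ (n - 2) * i"
        by (rule subgroup_with_reflection[OF K i])
      then show ?thesis using dih by simp
    next
      case False
      then have i: "el i True \<notin> K" for i by simp
      obtain k where "k \<le> n - 1" "K = rot k"
        by (rule subgroup_without_reflection[OF K i])
      then show ?thesis using rot by simp
    qed
  qed
  moreover have "rot 0 \<notin> case_prod dih ` index_set"
    using rot_0_conjugate_dih(1)[OF one_closed] by (auto simp: conjugate_one rot_dih_carrier)
  ultimately show ?thesis
    using card_index_set n_ge inj_on_dih by (simp add: card_image)
qed

end

section \<open>The presented semidihedral group\<close>

text \<open>
  The letters act on the pairs \<open>(i, e)\<close> as left multiplication acts on the normal forms \<open>a\<^sup>i b\<^sup>e\<close>;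
  up to congruence modulo \<open>2 ^ (n - 1)\<close> this respects the relations, so distinct normal forms
  are distinct elements.
\<close>

fun letter_act :: "nat \<Rightarrow> sd_generator \<times> bool \<Rightarrow> int \<times> bool \<Rightarrow> int \<times> bool" where
  "letter_act n (Gen_a, s) (i, e) = (if s then i + 1 else i - 1, e)"
| "letter_act n (Gen_b, s) (i, e) = ((2 ^ (n - 2) - 1) * i, \<not> e)"

section \<open>The action of words on exponent pairs modulo 2^(n-1)\<close>

definition state_eq :: "nat \<Rightarrow> int \<times> bool \<Rightarrow> int \<times> bool \<Rightarrow> bool" where
  "state_eq n p q \<longleftrightarrow> 2 ^ (n - 1) dvd fst p - fst q \<and> snd p = snd q"

lemma state_eq_refl: "state_eq n p p"
  by (simp add: state_eq_def)

lemma state_eq_sym: "state_eq n p q \<Longrightarrow> state_eq n q p"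
  by (simp add: state_eq_def dvd_diff_commute)

lemma state_eq_trans: "state_eq n p q \<Longrightarrow> state_eq n q r \<Longrightarrow> state_eq n p r"
  unfolding state_eq_def using dvd_add[of "2 ^ (n - 1)" "fst p - fst q" "fst q - fst r"] by simp

lemma letter_act_cong:
  assumes "state_eq n p q"
  shows "state_eq n (letter_act n l p) (letter_act n l q)"
proof -
  obtain x s where l: "l = (x, s)" by (rule prod.exhaust)
  obtain i e where p: "p = (i, e)" by (rule prod.exhaust)
  obtain j where q: "q = (j, e)" "2 ^ (n - 1) dvd i - j"
    using assms by (cases q) (simp add: state_eq_def p)
  have "2 ^ (n - 1) dvd (2 ^ (n - 2) - 1) * i - (2 ^ (n - 2) - 1) * j"
    using dvd_mult[OF q(2), of "2 ^ (n - 2) - 1"] by (simp only: right_diff_distrib)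
  then show ?thesis using q(2) by (cases x) (simp_all add: l p q(1) state_eq_def)
qed

lemma foldr_letter_act_cong:
  "state_eq n p q \<Longrightarrow> state_eq n (foldr (letter_act n) u p) (foldr (letter_act n) u q)"
  by (induction u) (simp_all add: letter_act_cong)

lemma foldr_word_power_a:
  "foldr (letter_act n) (word_power word_a k) (i, e) = (i + int k, e)"
  by (induction k) (simp_all add: word_power_def)

text \<open>The square differs from 1 by 2^(2n-4) - 2^(n-1), a multiple of 2^(n-1). Hence acting
  twice by b is trivial on exponents.\<close>

lemma twist_square:
  assumes "n \<ge> 4"
  shows "2 ^ (n - 1) dvd ((2::int) ^ (n - 2) - 1) * (2 ^ (n - 2) - 1) - 1"
proof -
  obtain m where m: "n = m + 4" using assms by (metis add.commute le_Suc_ex)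
  have "((2::int) ^ (n - 2) - 1) * (2 ^ (n - 2) - 1) - 1 = 2 ^ (n - 1) * (2 * 2 ^ m - 1)"
    by (simp add: m eval_nat_numeral algebra_simps)
  then show ?thesis by simp
qed

lemma twist_twist:
  assumes "n \<ge> 4"
  shows "2 ^ (n - 1) dvd ((2::int) ^ (n - 2) - 1) * ((2 ^ (n - 2) - 1) * i) - i"
  using dvd_mult2[OF twist_square[OF assms], of i] by (simp only: left_diff_distrib mult.assoc mult_1)

context
  fixes n :: nat
  assumes n: "n \<ge> 4"
begin

abbreviation (input) "SD \<equiv> semidihedral_group n"

definition sd_relations :: "(sd_generator gword \<times> sd_generator gword) set" where
  "sd_relations =
    {(word_power word_a (2 ^ (n - 1)), []),
     (word_power word_b 2, []),
     (word_b @ word_a @ word_b, word_power word_a (2 ^ (n - 2) - 1))}"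

lemma relation_act:
  assumes "(l, r) \<in> sd_relations"
  shows "state_eq n (foldr (letter_act n) l p) (foldr (letter_act n) r p)"
proof -
  obtain i e where p: "p = (i, e)" by (rule prod.exhaust)
  consider "l = word_power word_a (2 ^ (n - 1))" "r = []" | "l = word_power word_b 2" "r = []"
    | "l = word_b @ word_a @ word_b" "r = word_power word_a (2 ^ (n - 2) - 1)"
    using assms unfolding sd_relations_def by blast
  then show ?thesis
  proof cases
    case 1
    then show ?thesis by (simp add: p foldr_word_power_a state_eq_def)
  next
    case 2
    then show ?thesis using twist_twist[OF n, of i]
      by (simp add: p word_power_def numeral_2_eq_2 state_eq_def)
  next
    case 3
    have "foldr (letter_act n) l p =
        ((2 ^ (n - 2) - 1) * ((2 ^ (n - 2) - 1) * i) + (2 ^ (n - 2) - 1), e)"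
      by (simp add: 3 p distrib_left)
    moreover have "foldr (letter_act n) r p = (i + (2 ^ (n - 2) - 1), e)"
      by (simp add: 3 p foldr_word_power_a of_nat_diff)
    ultimately show ?thesis using twist_twist[OF n, of i] by (simp add: state_eq_def)
  qed
qed

lemma word_eq_act:
  "word_eq sd_relations u v \<Longrightarrow> state_eq n (foldr (letter_act n) u p) (foldr (letter_act n) v p)"
proof (induction arbitrary: p rule: word_eq.induct)
  case (refl u)
  show ?case by (rule state_eq_refl)
next
  case (sym u v)
  then show ?case by (blast intro: state_eq_sym)
next
  case (trans u v w)
  then show ?case by (blast intro: state_eq_trans)
next
  case (cancel u x e v)
  \<comment> \<open>For \<open>Gen_a\<close> the two shifts cancel exactly; \<open>Gen_b\<close> and
    its formal inverse act alike, so their product is the squared twist.\<close>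
  have "state_eq n (letter_act n (x, e) (letter_act n (x, \<not> e) q)) q" for q
    using twist_twist[OF n, of "fst q"] by (cases x; cases q) (simp_all add: state_eq_def)
  then show ?case by (simp add: foldr_letter_act_cong)
next
  case (relation l r u v)
  then show ?case by (simp only: foldr_append o_apply) (intro foldr_letter_act_cong relation_act)
qed

section \<open>Normal forms in the presented group\<close>

lemma SD_eq: "SD = presented_group sd_relations"
  by (simp only: semidihedral_group_def sd_relations_def)

interpretation SD: group SD
  unfolding SD_eq by (rule group_presented_group)

definition gen_a where "gen_a = word_class sd_relations word_a"
definition gen_b where "gen_b = word_class sd_relations word_b"

lemma carrier_SD: "carrier SD = range (word_class sd_relations)"
  by (simp add: SD_eq carrier_presented_group)

lemma word_class_closed: "word_class sd_relations u \<in> carrier SD"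
  unfolding carrier_SD by (rule rangeI)

lemma one_SD: "\<one>\<^bsub>SD\<^esub> = word_class sd_relations []"
  by (simp add: SD_eq one_presented_group)

lemma mult_SD: "word_class sd_relations u \<otimes>\<^bsub>SD\<^esub> word_class sd_relations v = word_class sd_relations (u @ v)"
  unfolding SD_eq by (rule mult_word_class)

lemma gen_closed [simp]: "gen_a \<in> carrier SD" "gen_b \<in> carrier SD"
  by (simp_all add: word_class_closed gen_a_def gen_b_def)

lemma word_class_power: "word_class sd_relations (word_power u k) = word_class sd_relations u [^]\<^bsub>SD\<^esub> k"
proof (induction k)
  case 0
  show ?case by (simp add: word_power_def one_SD)
next
  case (Suc k)
  have "word_class sd_relations (word_power u (Suc k)) =
      word_class sd_relations u \<otimes>\<^bsub>SD\<^esub> word_class sd_relations (word_power u k)"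
    by (simp add: mult_SD word_power_def)
  also have "\<dots> = word_class sd_relations u [^]\<^bsub>SD\<^esub> Suc k"
    unfolding Suc.IH by (rule SD.nat_pow_Suc2[symmetric]) (rule word_class_closed)
  finally show ?case .
qed

lemma word_class_relation:
  assumes "(l, r) \<in> sd_relations"
  shows "word_class sd_relations l = word_class sd_relations r"
  using word_eq.relation[OF assms, of "[]" "[]"] by (simp only: word_class_eq_iff append_Nil append_Nil2)

lemma gen_relations:
  "gen_a [^]\<^bsub>SD\<^esub> ((2::nat) ^ (n - 1)) = \<one>\<^bsub>SD\<^esub>"
  "gen_b \<otimes>\<^bsub>SD\<^esub> gen_b = \<one>\<^bsub>SD\<^esub>"
  "gen_b \<otimes>\<^bsub>SD\<^esub> gen_a \<otimes>\<^bsub>SD\<^esub> gen_b = gen_a [^]\<^bsub>SD\<^esub> ((2::nat) ^ (n - 2) - 1)"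
proof -
  show "gen_a [^]\<^bsub>SD\<^esub> ((2::nat) ^ (n - 1)) = \<one>\<^bsub>SD\<^esub>"
    unfolding gen_a_def one_SD word_class_power[symmetric] by (rule word_class_relation) (simp add: sd_relations_def)
  have "word_class sd_relations (word_power word_b 2) = word_class sd_relations []"
    by (rule word_class_relation) (simp add: sd_relations_def)
  then show "gen_b \<otimes>\<^bsub>SD\<^esub> gen_b = \<one>\<^bsub>SD\<^esub>"
    unfolding gen_b_def one_SD mult_SD by (simp add: word_power_def numeral_2_eq_2)
  have "word_class sd_relations (word_b @ word_a @ word_b) =
      word_class sd_relations (word_power word_a (2 ^ (n - 2) - 1))"
    by (rule word_class_relation) (simp add: sd_relations_def)
  then show "gen_b \<otimes>\<^bsub>SD\<^esub> gen_a \<otimes>\<^bsub>SD\<^esub> gen_b = gen_a [^]\<^bsub>SD\<^esub> ((2::nat) ^ (n - 2) - 1)"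
    unfolding gen_a_def gen_b_def mult_SD word_class_power[symmetric] by simp
qed

definition normal_form :: "int \<Rightarrow> bool \<Rightarrow> sd_generator gword set" where
  "normal_form i e = gen_a [^]\<^bsub>SD\<^esub> i \<otimes>\<^bsub>SD\<^esub> (if e then gen_b else \<one>\<^bsub>SD\<^esub>)"

lemma normal_form_closed: "normal_form i e \<in> carrier SD"
  by (simp add: normal_form_def)

lemma inv_gen_b: "inv\<^bsub>SD\<^esub> gen_b = gen_b"
  by (rule SD.inv_equality) (simp_all add: gen_relations)

lemma gen_b_power:
  "gen_b \<otimes>\<^bsub>SD\<^esub> gen_a [^]\<^bsub>SD\<^esub> (j::int) = gen_a [^]\<^bsub>SD\<^esub> ((2 ^ (n - 2) - 1) * j) \<otimes>\<^bsub>SD\<^esub> gen_b"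
proof -
  let ?c = "\<lambda>x. gen_b \<otimes>\<^bsub>SD\<^esub> x \<otimes>\<^bsub>SD\<^esub> gen_b"
  have bb: "gen_b \<otimes>\<^bsub>SD\<^esub> (gen_b \<otimes>\<^bsub>SD\<^esub> x) = x" if "x \<in> carrier SD" for x
    using that by (simp add: gen_relations flip: SD.m_assoc)
  \<comment> \<open>As b is its own inverse, \<open>?c\<close> is conjugation by b. A homomorphism
    commutes with integer powers, so the relation for bab determines it on all powers of a.\<close>
  have hom: "?c \<in> hom SD SD"
    by (rule homI) (simp_all add: SD.m_assoc bb)
  have "?c (gen_a [^]\<^bsub>SD\<^esub> j) = ?c gen_a [^]\<^bsub>SD\<^esub> j"
    by (rule hom_int_pow[OF hom gen_closed(1) SD.group_axioms SD.group_axioms])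
  also have "?c gen_a = gen_a [^]\<^bsub>SD\<^esub> ((2::int) ^ (n - 2) - 1)"
    unfolding gen_relations by (simp add: of_nat_diff flip: int_pow_int)
  also have "\<dots> [^]\<^bsub>SD\<^esub> j = gen_a [^]\<^bsub>SD\<^esub> (((2::int) ^ (n - 2) - 1) * j)"
    by (simp add: SD.int_pow_pow)
  finally have "?c (gen_a [^]\<^bsub>SD\<^esub> j) \<otimes>\<^bsub>SD\<^esub> gen_b = gen_a [^]\<^bsub>SD\<^esub> ((2 ^ (n - 2) - 1) * j) \<otimes>\<^bsub>SD\<^esub> gen_b"
    by simp
  then show ?thesis by (simp add: SD.m_assoc gen_relations)
qed

lemma normal_form_mult:
  "normal_form i e \<otimes>\<^bsub>SD\<^esub> normal_form j f =
    normal_form (if e then i + (2 ^ (n - 2) - 1) * j else i + j) (e \<noteq> f)"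
proof (cases e)
  case True
  have "normal_form i e \<otimes>\<^bsub>SD\<^esub> normal_form j f =
      gen_a [^]\<^bsub>SD\<^esub> i \<otimes>\<^bsub>SD\<^esub> (gen_b \<otimes>\<^bsub>SD\<^esub> gen_a [^]\<^bsub>SD\<^esub> j) \<otimes>\<^bsub>SD\<^esub> (if f then gen_b else \<one>\<^bsub>SD\<^esub>)"
    using True by (simp add: normal_form_def SD.m_assoc)
  also have "\<dots> = normal_form (i + (2 ^ (n - 2) - 1) * j) (\<not> f)"
    unfolding gen_b_power by (simp add: normal_form_def SD.m_assoc SD.int_pow_mult gen_relations)
  finally show ?thesis using True by simp
next
  case False
  then show ?thesis by (simp add: normal_form_def SD.m_assoc SD.int_pow_mult)
qed

lemma gen_a_pow_period:
  assumes "2 ^ (n - 1) dvd i - j"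
  shows "gen_a [^]\<^bsub>SD\<^esub> (i::int) = gen_a [^]\<^bsub>SD\<^esub> j"
proof -
  obtain c where c: "i = 2 ^ (n - 1) * c + j" using assms by (metis dvdE diff_add_cancel)
  have "gen_a [^]\<^bsub>SD\<^esub> ((2::int) ^ (n - 1)) = \<one>\<^bsub>SD\<^esub>"
    using gen_relations(1) int_pow_int[of SD gen_a "2 ^ (n - 1)"] by simp
  then show ?thesis by (simp add: c SD.int_pow_mult flip: SD.int_pow_pow)
qed

text \<open>Spells a normal form as a positive word, so that the letter action can be evaluated on
  it.\<close>

lemma normal_form_word:
  assumes "i \<ge> 0"
  shows "normal_form i e = word_class sd_relations (word_power word_a (nat i) @ (if e then word_b else []))"
proof -
  have "gen_a [^]\<^bsub>SD\<^esub> i = gen_a [^]\<^bsub>SD\<^esub> (nat i)"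
    using int_pow_int[of SD gen_a "nat i"] assms by simp
  also have "\<dots> = word_class sd_relations (word_power word_a (nat i))"
    by (simp add: word_class_power gen_a_def)
  finally show ?thesis by (simp add: normal_form_def gen_b_def one_SD mult_SD)
qed

lemma normal_form_eq_iff: "normal_form i e = normal_form j f \<longleftrightarrow> e = f \<and> 2 ^ (n - 1) dvd i - j"
proof
  assume "e = f \<and> 2 ^ (n - 1) dvd i - j"
  then show "normal_form i e = normal_form j f"
    by (simp add: normal_form_def gen_a_pow_period[of i j])
next
  let ?N = "2 ^ (n - 1) :: int"
  have red: "normal_form k d = normal_form (k mod ?N) d" for k d
    by (simp add: normal_form_def gen_a_pow_period[of k "k mod ?N"] minus_mod_eq_mult_div)
  \<comment> \<open>Acting on \<open>(0, False)\<close>, the word of a reduced normal form returns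
    its own exponent pair, so equal elements have congruent pairs.\<close>
  have act: "foldr (letter_act n) (word_power word_a (nat (k mod ?N)) @ (if d then word_b else [])) (0, False) = (k mod ?N, d)" for k d
    by (simp add: foldr_word_power_a)
  assume "normal_form i e = normal_form j f"
  then have "normal_form (i mod ?N) e = normal_form (j mod ?N) f" unfolding red[symmetric] .
  then have "word_eq sd_relations (word_power word_a (nat (i mod ?N)) @ (if e then word_b else []))
      (word_power word_a (nat (j mod ?N)) @ (if f then word_b else []))"
    by (simp only: normal_form_word pos_mod_sign zero_less_power zero_less_numeral word_class_eq_iff)
  from word_eq_act[OF this, of "(0, False)"]
  have "state_eq n (i mod ?N, e) (j mod ?N, f)" unfolding act .
  then have "e = f" "?N dvd i mod ?N - j mod ?N" by (simp_all add: state_eq_def)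
  then show "e = f \<and> ?N dvd i - j"
    using mod_eq_dvd_iff[of "i mod ?N" ?N "j mod ?N"] mod_eq_dvd_iff[of i ?N j] by simp
qed

text \<open>Each letter is a normal form, and \<open>normal_form_mult\<close> keeps products in
  normal form, so induction on the word suffices.\<close>

lemma word_class_normal_form: "\<exists>i e. word_class sd_relations u = normal_form i e"
proof (induction u)
  case Nil
  show ?case by (intro exI[of _ 0] exI[of _ False]) (simp add: normal_form_def flip: one_SD)
next
  case (Cons l u)
  have inv: "word_class sd_relations [(x, False)] = inv\<^bsub>SD\<^esub> word_class sd_relations [(x, True)]" for x
  proof (rule SD.inv_equality[symmetric])
    show "word_class sd_relations [(x, False)] \<otimes>\<^bsub>SD\<^esub> word_class sd_relations [(x, True)] = \<one>\<^bsub>SD\<^esub>"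
      unfolding mult_SD one_SD word_class_eq_iff
      using word_eq.cancel[of sd_relations "[]" x False "[]"] by simp
  qed (rule word_class_closed)+
  have a: "word_class sd_relations [(Gen_a, True)] = normal_form 1 False"
    "word_class sd_relations [(Gen_a, False)] = normal_form (- 1) False"
    unfolding inv gen_a_def[symmetric] by (simp_all add: normal_form_def SD.int_pow_neg)
  have b: "word_class sd_relations [(Gen_b, s)] = normal_form 0 True" for s
    by (cases s) (simp_all add: inv normal_form_def inv_gen_b flip: gen_b_def)
  obtain x s where l: "l = (x, s)" by (rule prod.exhaust)
  have "\<exists>i e. word_class sd_relations [l] = normal_form i e"
    unfolding l by (cases x; cases s; simp only: a b) blast+
  then obtain i e where ie: "word_class sd_relations [l] = normal_form i e" by (elim exE)
  obtain j f where jf: "word_class sd_relations u = normal_form j f" using Cons.IH by (elim exE)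
  have "word_class sd_relations (l # u) = normal_form i e \<otimes>\<^bsub>SD\<^esub> normal_form j f"
    unfolding ie[symmetric] jf[symmetric] mult_SD by simp
  then show ?case unfolding normal_form_mult by (intro exI)
qed

lemma semidihedral_normal_form: "semidihedral SD n normal_form"
proof
  show "4 \<le> n" by (rule n)
  show "carrier SD = {normal_form i e |i e. True}"
    using word_class_normal_form normal_form_closed unfolding carrier_SD by blast
qed (rule normal_form_mult normal_form_eq_iff)+

end

theorem theoremA:
  fixes n :: nat
  assumes "n \<ge> 4"
  shows "width (semidihedral_group n) = 2 * n - 2"
  by (rule semidihedral.width_eq[OF semidihedral_normal_form[OF assms]])

end
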